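(* Let $\{\mathcal L_\alpha\}_{\alpha\in\Omega}$ be a family of orthocomplemented simple closure spaces, $\mathcal L_\alpha$ on $\Sigma_\alpha$. Then the Aerts separated product equals $\underline{\bigotimes}_\alpha\mathcal L_\alpha$, i.e. $$\mathrm{Aerts}_\alpha(\mathcal L_\alpha)=\underline{\bigotimes}_\alpha\mathcal L_\alpha,$$ and $\mathrm{Aerts}_\alpha(\mathcal L_\alpha)$ is orthocomplemented.
   Context: A simple closure space on a nonempty set $\Sigma$ is a set $\mathcal L\subseteq 2^\Sigma$, ordered by inclusion, closed under arbitrary intersections and containing $\Sigma$, $\emptyset$ and all singletons. It is a complete atomistic lattice whose atoms are the singletons. A lattice $\mathcal L$ with $0$ and $1$ is orthocomplemented if there is a unary operation ${}^\perp:\mathcal L\to\mathcal L$ such that for all $a,b\in\mathcal L$: $(a^\perp)^\perp=a$; $a\le b$ implies $b^\perp\le a^\perp$; and $a\wedge a^\perp=0$. If $\mathcal L$ is an orthocomplemented simple closure space on $\Sigma$ and $p,q\in\Sigma$, write $p\perp q$ if $p\in\{q\}^\perp$. Let $\mathbf\Sigma=\prod_\alpha\Sigma_\alpha$ with coordinate maps $\pi_\alpha$. Let $\#$ be the binary relation on $\mathbf\Sigma$ defined by: $p\#q$ iff there is $\beta\in\Omega$ with $p_\beta\perp_\beta q_\beta$ (where $\perp_\beta$ is the relation of $\mathcal L_\beta$). For $R\subseteq\mathbf\Sigma$ put $R^\#=\{q\in\mathbf\Sigma: q\#p\ \text{for all } p\in R\}$. The Aerts separated product is $\mathrm{Aerts}_\alpha(\mathcal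 L_\alpha):=\{R\subseteq\mathbf\Sigma: R^{\#\#}=R\}$, ordered by inclusion. Also $\underline{\bigotimes}_\alpha\mathcal L_\alpha:=\{\bigcap\omega:\ \omega\subseteq\{\bigcup_\alpha\pi_\alpha^{-1}(a_\alpha): a\in\prod_\alpha\mathcal L_\alpha\}\}$ (with $\bigcap\emptyset=\mathbf\Sigma$), ordered by inclusion. *)

theory Defs
  imports "HOL-Algebra.Lattice" "HOL-Library.FuncSet"
begin

text \<open>The convention that the empty intersection is \<open>\<Sigma>\<close> is covered by \<open>space_mem\<close>;
  \<open>\<Inter>{}\<close> is \<open>UNIV\<close> in HOL, hence the restriction to nonempty \<open>\<omega>\<close>.\<close>

locale simple_closure_space =
  fixes \<Sigma> :: "'a set" and L :: "'a set set"
  assumes space_nonempty: "\<Sigma> \<noteq> {}"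
    and subsets: "L \<subseteq> Pow \<Sigma>"
    and Inter_mem: "\<And>\<omega>. \<omega> \<subseteq> L \<Longrightarrow> \<omega> \<noteq> {} \<Longrightarrow> \<Inter>\<omega> \<in> L"
    and space_mem: "\<Sigma> \<in> L"
    and empty_mem: "{} \<in> L"
    and singleton_mem: "\<And>p. p \<in> \<Sigma> \<Longrightarrow> {p} \<in> L"

abbreviation inclusion_order :: "'a set set \<Rightarrow> 'a set gorder" where
  "inclusion_order L \<equiv> \<lparr>carrier = L, eq = (=), le = (\<subseteq>)\<rparr>"

locale orthocomplementation = bounded_lattice L for L (structure) +
  fixes oc :: "'a \<Rightarrow> 'a"
  assumes oc_closed: "a \<in> carrier L \<Longrightarrow> oc a \<in> carrier L"
    and oc_oc: "a \<in> carrier L \<Longrightarrow> oc (oc a) = a"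
    and oc_antitone: "\<lbrakk>a \<in> carrier L; b \<in> carrier L; a \<sqsubseteq> b\<rbrakk> \<Longrightarrow> oc b \<sqsubseteq> oc a"
    and meet_oc: "a \<in> carrier L \<Longrightarrow> a \<sqinter> oc a = \<bottom>"

definition orthocomplemented :: "('a, 'b) gorder_scheme \<Rightarrow> bool" where
  "orthocomplemented L \<longleftrightarrow> (\<exists>oc. orthocomplementation L oc)"

definition orthogonal :: "('a set \<Rightarrow> 'a set) \<Rightarrow> 'a \<Rightarrow> 'a \<Rightarrow> bool" where
  "orthogonal oc p q \<longleftrightarrow> p \<in> oc {q}"

text \<open>Below, \<open>I\<close> is the index set, \<open>\<Sigma> \<alpha>\<close> the underlying set of the \<open>\<alpha>\<close>-th factor \<open>L \<alpha>\<close>, and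
  \<open>oc \<alpha>\<close> its orthocomplementation.  The product of the underlying sets is the extensional
  product \<open>Pi\<^sub>E I \<Sigma>\<close>.\<close>

definition sharp :: "'i set \<Rightarrow> ('i \<Rightarrow> 'a set \<Rightarrow> 'a set) \<Rightarrow> ('i \<Rightarrow> 'a) \<Rightarrow> ('i \<Rightarrow> 'a) \<Rightarrow> bool" where
  "sharp I oc p q \<longleftrightarrow> (\<exists>\<beta>\<in>I. orthogonal (oc \<beta>) (p \<beta>) (q \<beta>))"

definition sharp_set ::
  "'i set \<Rightarrow> ('i \<Rightarrow> 'a set) \<Rightarrow> ('i \<Rightarrow> 'a set \<Rightarrow> 'a set) \<Rightarrow> ('i \<Rightarrow> 'a) set \<Rightarrow> ('i \<Rightarrow> 'a) set" where
  "sharp_set I \<Sigma> oc R = {q \<in> Pi\<^sub>E I \<Sigma>. \<forall>p\<in>R. sharp I oc q p}"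

definition Aerts ::
  "'i set \<Rightarrow> ('i \<Rightarrow> 'a set) \<Rightarrow> ('i \<Rightarrow> 'a set \<Rightarrow> 'a set) \<Rightarrow> ('i \<Rightarrow> 'a) set set" where
  "Aerts I \<Sigma> oc = {R. R \<subseteq> Pi\<^sub>E I \<Sigma> \<and> sharp_set I \<Sigma> oc (sharp_set I \<Sigma> oc R) = R}"

definition cylinder_union ::
  "'i set \<Rightarrow> ('i \<Rightarrow> 'a set) \<Rightarrow> ('i \<Rightarrow> 'a set) \<Rightarrow> ('i \<Rightarrow> 'a) set" where
  "cylinder_union I \<Sigma> a = (\<Union>\<alpha>\<in>I. {p \<in> Pi\<^sub>E I \<Sigma>. p \<alpha> \<in> a \<alpha>})"

text \<open>Intersecting with \<open>Pi\<^sub>E I \<Sigma>\<close> only matters for \<open>\<omega> = {}\<close>, whose intersection is taken inside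
  the product.\<close>

definition lower_tensor ::
  "'i set \<Rightarrow> ('i \<Rightarrow> 'a set) \<Rightarrow> ('i \<Rightarrow> 'a set set) \<Rightarrow> ('i \<Rightarrow> 'a) set set" where
  "lower_tensor I \<Sigma> L =
    {Pi\<^sub>E I \<Sigma> \<inter> \<Inter>\<omega> | \<omega>. \<omega> \<subseteq> cylinder_union I \<Sigma> ` Pi\<^sub>E I L}"

end

theory Submission
  imports Defs
begin

text \<open>
  Both sides consist of the polars \<open>R\<^sup>#\<close>. Symmetry and irreflexivity of \<open>\<bottom>\<^sub>\<beta>\<close> pass to
  \<open>#\<close>, and for any symmetric irreflexive relation the bipolar-closed sets are exactly the polars
  and are orthocomplemented by \<open>R \<mapsto> R\<^sup>#\<close>.

  For the equality, a polar is the intersection of the polars of the points \<open>p\<close> of \<open>R\<close>,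
  and the polar of a point is the cylinder union over \<open>\<beta> \<mapsto> {p \<beta>}\<^sup>\<bottom>\<close>. Conversely, each
  \<open>a \<in> L \<beta>\<close> is the set of points orthogonal to every point of \<open>a\<^sup>\<bottom>\<close>, and a choice of
  witnesses, one per coordinate, turns this into the statement that the cylinder union over
  \<open>a\<close> is the polar of the box \<open>\<Prod>\<^sub>\<beta> (a \<beta>)\<^sup>\<bottom>\<close>. Intersections of polars are polars of
  unions.
\<close>

section \<open>Polarity of a symmetric irreflexive relation\<close>

locale orthogonality_space =
  fixes X :: "'a set" and orth :: "'a \<Rightarrow> 'a \<Rightarrow> bool"
  assumes orth_sym: "\<lbrakk>p \<in> X; q \<in> X; orth p q\<rbrakk> \<Longrightarrow> orth q p"
    and orth_irrefl: "p \<in> X \<Longrightarrow> \<not> orth p p"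
begin

definition polar :: "'a set \<Rightarrow> 'a set" where
  "polar R = {q \<in> X. \<forall>p\<in>R. orth q p}"

definition closed_sets :: "'a set set" where
  "closed_sets = {R. R \<subseteq> X \<and> polar (polar R) = R}"

lemma polar_subset: "polar R \<subseteq> X"
  unfolding polar_def by blast

lemma polar_antitone: "R \<subseteq> S \<Longrightarrow> polar S \<subseteq> polar R"
  unfolding polar_def by blast

lemma subset_bipolar: "R \<subseteq> X \<Longrightarrow> R \<subseteq> polar (polar R)"
  unfolding polar_def using orth_sym by blast

lemma polar_bipolar:
  assumes "R \<subseteq> X"
  shows "polar (polar (polar R)) = polar R"
  using polar_antitone[OF subset_bipolar[OF assms]] subset_bipolar[OF polar_subset] by blast

lemma polar_closed: "R \<subseteq> X \<Longrightarrow> polar R \<in> closed_sets"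
  unfolding closed_sets_def using polar_subset polar_bipolar by blast

lemma closed_sets_eq_polars: "closed_sets = polar ` Pow X"
proof
  show "closed_sets \<subseteq> polar ` Pow X"
  proof
    fix R assume "R \<in> closed_sets"
    then have "R = polar (polar R)"
      unfolding closed_sets_def by simp
    then show "R \<in> polar ` Pow X"
      using polar_subset[of R] by blast
  qed
qed (use polar_closed in blast)

lemma polar_Union: "X \<inter> \<Inter>(polar ` \<R>) = polar (\<Union>\<R>)"
  unfolding polar_def by blast

lemma closed_sets_Inter:
  assumes "\<omega> \<subseteq> closed_sets"
  shows "X \<inter> \<Inter>\<omega> \<in> closed_sets"
proof -
  have "polar (polar R) = R" if "R \<in> \<omega>" for R
    using that assms unfolding closed_sets_def by blast
  then have "polar ` polar ` \<omega> = \<omega>"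
    by (simp add: image_image)
  then have "X \<inter> \<Inter>\<omega> = polar (\<Union>(polar ` \<omega>))"
    using polar_Union[of "polar ` \<omega>"] by simp
  moreover have "\<Union>(polar ` \<omega>) \<subseteq> X"
    using polar_subset by blast
  ultimately show ?thesis
    using polar_closed by simp
qed

lemma disjoint_polar: "R \<subseteq> X \<Longrightarrow> R \<inter> polar R = {}"
  unfolding polar_def using orth_irrefl by blast

lemma space_closed: "X \<in> closed_sets"
  using closed_sets_Inter[of "{}"] by simp

lemma empty_closed: "{} \<in> closed_sets"
proof -
  have "polar X = {}"
    using disjoint_polar[of X] polar_subset[of X] by blast
  then show ?thesis
    using polar_closed[of X] by simp
qed

text \<open>Meets are intersections, and the join of two closed sets is the bipolar of their union, so
  the axiom \<open>R \<sqinter> R\<^sup># = \<bottom>\<close> is the disjointness of \<open>R\<close> and \<open>R\<^sup>#\<close>.\<close>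

lemma orthocomplementation_polar:
  "orthocomplementation (inclusion_order closed_sets) polar"
proof -
  let ?L = "inclusion_order closed_sets"
  interpret partial_order ?L
    by unfold_locales auto
  have inf: "greatest ?L (R \<inter> S) (Lower ?L {R, S})"
    if "R \<in> closed_sets" "S \<in> closed_sets" for R S
  proof -
    have "X \<inter> \<Inter>{R, S} = R \<inter> S"
      using that unfolding closed_sets_def by blast
    then have "R \<inter> S \<in> closed_sets"
      using closed_sets_Inter[of "{R, S}"] that by simp
    then show ?thesis
      using that by (auto simp: greatest_def Lower_def)
  qed
  have sup: "least ?L (polar (polar (R \<union> S))) (Upper ?L {R, S})"
    if "R \<in> closed_sets" "S \<in> closed_sets" for R S
  proof -
    have sub: "R \<union> S \<subseteq> X"
      using that unfolding closed_sets_def by blast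
    have "polar (polar (R \<union> S)) \<subseteq> T" if "T \<in> closed_sets" "R \<union> S \<subseteq> T" for T
      using polar_antitone[OF polar_antitone[OF that(2)]] that(1)
      unfolding closed_sets_def by simp
    then show ?thesis
      using that subset_bipolar[OF sub] polar_closed[OF polar_subset]
      by (auto simp: least_def Upper_def)
  qed
  have bot: "least ?L {} (carrier ?L)"
    using empty_closed by (auto simp: least_def)
  have top: "greatest ?L X (carrier ?L)"
    using space_closed by (auto simp: greatest_def closed_sets_def)
  interpret bounded_lattice ?L
  proof
    show "\<exists>s. least ?L s (Upper ?L {R, S})" if "R \<in> carrier ?L" "S \<in> carrier ?L" for R S
      using sup that by auto
    show "\<exists>s. greatest ?L s (Lower ?L {R, S})" if "R \<in> carrier ?L" "S \<in> carrier ?L" for R S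
      using inf that by auto
  qed (use bot top in blast)+
  have bottom_eq: "\<bottom>\<^bsub>?L\<^esub> = {}"
    using bottom_lower[of "{}"] empty_closed by simp
  show ?thesis
  proof unfold_locales
    fix R assume "R \<in> carrier ?L"
    then have R: "R \<in> closed_sets" "R \<subseteq> X"
      by (auto simp: closed_sets_def)
    then have "R \<sqinter>\<^bsub>?L\<^esub> polar R \<subseteq> R \<inter> polar R"
      using meet_left[of R "polar R"] meet_right[of R "polar R"] polar_closed by simp
    then show "R \<sqinter>\<^bsub>?L\<^esub> polar R = \<bottom>\<^bsub>?L\<^esub>"
      using disjoint_polar[OF R(2)] bottom_eq by simp
  qed (auto simp: polar_closed polar_antitone closed_sets_def polar_subset polar_bipolar)
qed

end

section \<open>Orthogonality of points in an orthocomplemented closure space\<close>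

locale orthocomplemented_closure_space =
  simple_closure_space \<Sigma> L + orthocomplementation "inclusion_order L" oc
  for \<Sigma> :: "'a set" and L oc
begin

text \<open>An antitone involution is a Galois connection with itself, so the two sides of
  \<open>{p} \<subseteq> b\<^sup>\<bottom>\<close> can be exchanged. For an atom \<open>b\<close> this is the symmetry of
  orthogonality; for \<open>b = a\<^sup>\<bottom>\<close> it recovers \<open>a\<close> from the orthogonality of points.\<close>

lemma mem_oc_iff:
  assumes p: "p \<in> \<Sigma>" and b: "b \<in> L"
  shows "p \<in> oc b \<longleftrightarrow> b \<subseteq> oc {p}"
proof
  assume "p \<in> oc b"
  then have "oc (oc b) \<subseteq> oc {p}"
    using oc_antitone[of "{p}" "oc b"] oc_closed[of b] singleton_mem[OF p] b by simp
  then show "b \<subseteq> oc {p}"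
    using oc_oc b by simp
next
  assume "b \<subseteq> oc {p}"
  then have "oc (oc {p}) \<subseteq> oc b"
    using oc_antitone[of b "oc {p}"] oc_closed[of "{p}"] singleton_mem[OF p] b by simp
  then show "p \<in> oc b"
    using oc_oc singleton_mem[OF p] by simp
qed

lemma orthogonal_sym:
  assumes "p \<in> \<Sigma>" "q \<in> \<Sigma>" "orthogonal oc p q"
  shows "orthogonal oc q p"
  using mem_oc_iff[OF assms(1) singleton_mem[OF assms(2)]] assms(3)
  by (simp add: orthogonal_def)

lemma bottom_eq_empty: "\<bottom>\<^bsub>inclusion_order L\<^esub> = {}"
  using bottom_lower[of "{}"] empty_mem by simp

lemma orthogonal_irrefl:
  assumes p: "p \<in> \<Sigma>"
  shows "\<not> orthogonal oc p p"
proof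
  assume "orthogonal oc p p"
  then have "{p} \<subseteq> {p} \<sqinter>\<^bsub>inclusion_order L\<^esub> oc {p}"
    using meet_le[of "{p}" "{p}" "oc {p}"] singleton_mem[OF p] oc_closed[of "{p}"]
    by (simp add: orthogonal_def)
  then show False
    using meet_oc[of "{p}"] singleton_mem[OF p] bottom_eq_empty by simp
qed

lemma mem_iff_orthogonal:
  assumes p: "p \<in> \<Sigma>" and a: "a \<in> L"
  shows "p \<in> a \<longleftrightarrow> (\<forall>r\<in>oc a. orthogonal oc p r)"
proof -
  have oca: "oc a \<in> L"
    using oc_closed a by simp
  then have "p \<in> a \<longleftrightarrow> oc a \<subseteq> oc {p}"
    using mem_oc_iff[OF p oca] oc_oc a by simp
  moreover have "r \<in> oc {p} \<longleftrightarrow> orthogonal oc p r" if "r \<in> oc a" for r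
    using that oca subsets orthogonal_sym[of p r] orthogonal_sym[of r p] p
    by (auto simp: orthogonal_def)
  ultimately show ?thesis
    by blast
qed

end

section \<open>Polars in a product\<close>

locale orthocomplemented_family =
  fixes I :: "'i set" and \<Sigma> :: "'i \<Rightarrow> 'a set" and L oc
  assumes factor: "\<alpha> \<in> I \<Longrightarrow> orthocomplemented_closure_space (\<Sigma> \<alpha>) (L \<alpha>) (oc \<alpha>)"
begin

lemma orthogonality_space_sharp: "orthogonality_space (Pi\<^sub>E I \<Sigma>) (sharp I oc)"
proof
  fix p q assume "p \<in> Pi\<^sub>E I \<Sigma>" "q \<in> Pi\<^sub>E I \<Sigma>" "sharp I oc p q"
  then show "sharp I oc q p"
    unfolding sharp_def
    using orthocomplemented_closure_space.orthogonal_sym[OF factor] by (meson PiE_mem)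
next
  fix p assume "p \<in> Pi\<^sub>E I \<Sigma>"
  then show "\<not> sharp I oc p p"
    unfolding sharp_def
    using orthocomplemented_closure_space.orthogonal_irrefl[OF factor] by (meson PiE_mem)
qed

sublocale orthogonality_space "Pi\<^sub>E I \<Sigma>" "sharp I oc"
  by (rule orthogonality_space_sharp)

lemma sharp_set_eq_polar: "sharp_set I \<Sigma> oc R = polar R"
  by (simp add: sharp_set_def polar_def)

lemma Aerts_eq_closed_sets: "Aerts I \<Sigma> oc = closed_sets"
  by (simp add: Aerts_def closed_sets_def sharp_set_eq_polar)

lemma polar_singleton: "polar {p} = cylinder_union I \<Sigma> (\<lambda>\<beta>\<in>I. oc \<beta> {p \<beta>})"
  by (auto simp: polar_def sharp_def orthogonal_def cylinder_union_def)

lemma oc_singletons_mem: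
  assumes "p \<in> Pi\<^sub>E I \<Sigma>"
  shows "(\<lambda>\<beta>\<in>I. oc \<beta> {p \<beta>}) \<in> Pi\<^sub>E I L"
proof (rule restrict_PiE_iff[THEN iffD2], rule ballI)
  fix \<beta> assume \<beta>: "\<beta> \<in> I"
  then interpret orthocomplemented_closure_space "\<Sigma> \<beta>" "L \<beta>" "oc \<beta>"
    by (rule factor)
  show "oc \<beta> {p \<beta>} \<in> L \<beta>"
    using oc_closed[of "{p \<beta>}"] singleton_mem PiE_mem[OF assms \<beta>] by simp
qed

text \<open>A point outside the cylinder union misses every \<open>a \<beta>\<close>, so in each coordinate some point
  of \<open>(a \<beta>)\<^sup>\<bottom>\<close> is not orthogonal to it. Choosing all these at once gives a single point of the
  box that is not \<open>#\<close>-related to it.\<close>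

lemma cylinder_union_eq_polar:
  assumes a: "a \<in> Pi\<^sub>E I L"
  shows "cylinder_union I \<Sigma> a = polar (Pi\<^sub>E I (\<lambda>\<beta>. oc \<beta> (a \<beta>)))"
proof -
  have mem: "x \<beta> \<in> a \<beta> \<longleftrightarrow> (\<forall>r\<in>oc \<beta> (a \<beta>). orthogonal (oc \<beta>) (x \<beta>) r)"
    if "x \<in> Pi\<^sub>E I \<Sigma>" "\<beta> \<in> I" for x \<beta>
    using orthocomplemented_closure_space.mem_iff_orthogonal[OF factor[OF that(2)]]
      PiE_mem[OF that] PiE_mem[OF a that(2)] by blast
  have "(\<exists>\<beta>\<in>I. x \<beta> \<in> a \<beta>) \<longleftrightarrow> (\<forall>r\<in>Pi\<^sub>E I (\<lambda>\<beta>. oc \<beta> (a \<beta>)). sharp I oc x r)"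
    if x: "x \<in> Pi\<^sub>E I \<Sigma>" for x
  proof
    assume "\<exists>\<beta>\<in>I. x \<beta> \<in> a \<beta>"
    then show "\<forall>r\<in>Pi\<^sub>E I (\<lambda>\<beta>. oc \<beta> (a \<beta>)). sharp I oc x r"
      unfolding sharp_def using mem[OF x] by (meson PiE_mem)
  next
    assume all: "\<forall>r\<in>Pi\<^sub>E I (\<lambda>\<beta>. oc \<beta> (a \<beta>)). sharp I oc x r"
    show "\<exists>\<beta>\<in>I. x \<beta> \<in> a \<beta>"
    proof (rule ccontr)
      assume "\<not> (\<exists>\<beta>\<in>I. x \<beta> \<in> a \<beta>)"
      then have "\<forall>\<beta>\<in>I. \<exists>r. r \<in> oc \<beta> (a \<beta>) \<and> \<not> orthogonal (oc \<beta>) (x \<beta>) r"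
        using mem[OF x] by blast
      then obtain r where
        r: "\<forall>\<beta>\<in>I. r \<beta> \<in> oc \<beta> (a \<beta>) \<and> \<not> orthogonal (oc \<beta>) (x \<beta>) (r \<beta>)"
        by (rule bchoice[THEN exE])
      then have "restrict r I \<in> Pi\<^sub>E I (\<lambda>\<beta>. oc \<beta> (a \<beta>))"
        by simp
      moreover have "\<not> sharp I oc x (restrict r I)"
        using r by (simp add: sharp_def)
      ultimately show False
        using all by blast
    qed
  qed
  then show ?thesis
    by (auto simp: cylinder_union_def polar_def)
qed

lemma cylinder_union_closed:
  assumes a: "a \<in> Pi\<^sub>E I L"
  shows "cylinder_union I \<Sigma> a \<in> closed_sets"
proof -
  have "oc \<beta> (a \<beta>) \<subseteq> \<Sigma> \<beta>" if "\<beta> \<in> I" for \<beta>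
  proof -
    interpret orthocomplemented_closure_space "\<Sigma> \<beta>" "L \<beta>" "oc \<beta>"
      using that by (rule factor)
    show ?thesis
      using oc_closed[of "a \<beta>"] subsets PiE_mem[OF a that] by auto
  qed
  then show ?thesis
    unfolding cylinder_union_eq_polar[OF a] by (intro polar_closed PiE_mono)
qed

text \<open>A polar is the intersection of the polars of its generating points, each of which is a
  cylinder union; the other inclusion holds because closed sets are
  stable under intersections and contain the cylinder unions.\<close>

lemma closed_sets_eq_lower_tensor: "closed_sets = lower_tensor I \<Sigma> L"
proof
  show "closed_sets \<subseteq> lower_tensor I \<Sigma> L"
  proof
    fix R assume "R \<in> closed_sets"
    then obtain S where S: "S \<subseteq> Pi\<^sub>E I \<Sigma>" "R = polar S"
      unfolding closed_sets_eq_polars by blast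
    let ?\<omega> = "polar ` (\<lambda>p. {p}) ` S"
    have "?\<omega> \<subseteq> cylinder_union I \<Sigma> ` Pi\<^sub>E I L"
      using S(1) oc_singletons_mem by (auto simp: polar_singleton)
    moreover have "R = Pi\<^sub>E I \<Sigma> \<inter> \<Inter>?\<omega>"
      unfolding polar_Union S(2) by simp
    ultimately show "R \<in> lower_tensor I \<Sigma> L"
      unfolding lower_tensor_def by blast
  qed
next
  show "lower_tensor I \<Sigma> L \<subseteq> closed_sets"
  proof
    fix R assume "R \<in> lower_tensor I \<Sigma> L"
    then obtain \<omega> where "\<omega> \<subseteq> cylinder_union I \<Sigma> ` Pi\<^sub>E I L" "R = Pi\<^sub>E I \<Sigma> \<inter> \<Inter>\<omega>"
      unfolding lower_tensor_def by blast
    then show "R \<in> closed_sets"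
      using closed_sets_Inter[of \<omega>] cylinder_union_closed by blast
  qed
qed

end

section \<open>The separated product\<close>

theorem lemma3p4:
  fixes I :: "'i set"
    and \<Sigma> :: "'i \<Rightarrow> 'a set"
    and L :: "'i \<Rightarrow> 'a set set"
    and oc :: "'i \<Rightarrow> 'a set \<Rightarrow> 'a set"
  assumes "\<And>\<alpha>. \<alpha> \<in> I \<Longrightarrow> simple_closure_space (\<Sigma> \<alpha>) (L \<alpha>)"
    and "\<And>\<alpha>. \<alpha> \<in> I \<Longrightarrow> orthocomplementation (inclusion_order (L \<alpha>)) (oc \<alpha>)"
  shows "Aerts I \<Sigma> oc = lower_tensor I \<Sigma> L
    \<and> orthocomplemented (inclusion_order (Aerts I \<Sigma> oc))"
proof -
  interpret orthocomplemented_family I \<Sigma> L oc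
    using assms by (simp add: orthocomplemented_family_def orthocomplemented_closure_space_def)
  show ?thesis
    using closed_sets_eq_lower_tensor orthocomplementation_polar
    unfolding Aerts_eq_closed_sets orthocomplemented_def by blast
qed

end
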